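(* Let $\mathscr D$ be a symmetric monoidal duploid, $\mathscr M$ a cartesian category, and let $\mathrm{Lin}:\mathscr M\to\mathscr D$, $\mathrm{Mult}:\mathscr D\rightharpoonup\mathscr M$ form a direct linear-non-linear adjunction, i.e. a positive adjunction such that the functor $\mathscr M\to\mathscr P_t$ induced by $\mathrm{Lin}$ is strong monoidal. Then it induces a $\Downarrow$-relative linear-non-linear coadjunction for $\Downarrow:\mathscr N_l\to\mathscr P_t$: the functors $\mathrm{Lin}:\mathscr M\to\mathscr P_t$ (which is strong monoidal) and $\mathrm{Mult}:\mathscr N_l\to\mathscr M$ (the restriction of $\mathrm{Mult}$) come with bijections $$\mathscr P_t(\mathrm{Lin}X,\Downarrow N)\cong\mathscr M(X,\mathrm{Mult}N)$$ natural in $X\in\mathscr M$ and $N\in\mathscr N_l$.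
   Context: A non-associative category is a category without the associativity axiom. A bare functor $\rightharpoonup$ is a morphism of reflexive graphs (preserves identities, not necessarily composition). A morphism $f$ is thunkable if $(h\circ g)\circ f=h\circ(g\circ f)$ for all composable $g,h$; $h$ is linear if $(h\circ g)\circ f=h\circ(g\circ f)$ for all composable $f,g$. An object is positive if every morphism out of it is linear, negative if every morphism into it is thunkable. An adjunction over non-associative categories $\mathscr D,\mathscr E$: bare functors $F:\mathscr D\rightharpoonup\mathscr E$, $G:\mathscr E\rightharpoonup\mathscr D$ with bijections $\varphi:\mathscr E(FA,B)\cong\mathscr D(A,GB)$ such that $\varphi(g\circ h)=Gg\circ\varphi(h)$ and $\varphi(h\circ Ff)=\varphi(h)\circ f$. It is positive if every $FA$ is positive, negative if every $GB$ is negative. A duploid is a non-associative category $\mathscr D$ in which every object is positive or negative, and in which the identity functor has a left adjoint $\Downarrow:\mathscr D\rightharpoonup\mathscr D$ with positive values and a right adjoint $\Uparrow:\mathscr D\rightharpoonup\mathscr D$ with negative values. $\mathscr P_t$ is the category of positive objects and thunkable morphisms; $\mathscr N_l$ is the category of negative objects and linear morphisms; $\Downarrow$ restricts to a functor $\mathscr N_l\to\mathscr P_t$. The left adjoint of a positive adjunction from a category $\mathscr M$ is a functor corestricting to $\mathscr M\to\mathscr P_t$, and right adjoints restrict to functors on linear maps. A symmetric monoidal duploid is a duploid equipped with a tensor product, which in particular makes $\mathscr P_t$ a symmetric monoidal category; the induced symmetric monoidal structure on $\mathscr P_t$ is the only part of the structure to which the present statement refers. A cartesian category is a category with finite products, viewed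 as a symmetric monoidal category. For a functor $R:\mathscr B\to\mathscr A$ with $\mathscr A$ symmetric monoidal, an $R$-relative linear-non-linear coadjunction consists of a cartesian category $\mathscr M$, a strong monoidal functor $\mathrm{Lin}:\mathscr M\to\mathscr A$, a functor $\mathrm{Mult}:\mathscr B\to\mathscr M$, and bijections $\mathscr A(\mathrm{Lin}X,RB)\cong\mathscr M(X,\mathrm{Mult}B)$ natural in $X$ and $B$. *)

theory Defs
  imports Main
begin

record ('o, 'm) cat_graph =
  Ob :: "'o set"
  Ar :: "'m set"
  Src :: "'m \<Rightarrow> 'o"
  Tgt :: "'m \<Rightarrow> 'o"
  Idn :: "'o \<Rightarrow> 'm"
  Cmp :: "'m \<Rightarrow> 'm \<Rightarrow> 'm" (infixl "\<cdot>\<index>" 70)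

definition hom :: "('o, 'm, 'z) cat_graph_scheme \<Rightarrow> 'o \<Rightarrow> 'o \<Rightarrow> 'm set" where
  "hom C A B = {f \<in> Ar C. Src C f = A \<and> Tgt C f = B}"

locale nonassoc_category =
  fixes C :: "('o, 'm) cat_graph" (structure)
  assumes Src_Ob: "f \<in> Ar C \<Longrightarrow> Src C f \<in> Ob C"
    and Tgt_Ob: "f \<in> Ar C \<Longrightarrow> Tgt C f \<in> Ob C"
    and Idn_hom: "A \<in> Ob C \<Longrightarrow> Idn C A \<in> hom C A A"
    and Cmp_hom: "\<lbrakk>f \<in> hom C A B; g \<in> hom C B E\<rbrakk> \<Longrightarrow> g \<cdot> f \<in> hom C A E"
    and Idn_left: "f \<in> hom C A B \<Longrightarrow> Idn C B \<cdot> f = f"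
    and Idn_right: "f \<in> hom C A B \<Longrightarrow> f \<cdot> Idn C A = f"

locale category = nonassoc_category +
  assumes Cmp_assoc:
    "\<lbrakk>f \<in> hom C A B; g \<in> hom C B E; h \<in> hom C E K\<rbrakk> \<Longrightarrow> (h \<cdot> g) \<cdot> f = h \<cdot> (g \<cdot> f)"

definition iso_arrow :: "('o, 'm) cat_graph \<Rightarrow> 'o \<Rightarrow> 'o \<Rightarrow> 'm \<Rightarrow> bool" where
  "iso_arrow C A B f \<longleftrightarrow> f \<in> hom C A B \<and>
     (\<exists>g \<in> hom C B A. g \<cdot>\<^bsub>C\<^esub> f = Idn C A \<and> f \<cdot>\<^bsub>C\<^esub> g = Idn C B)"

definition thunkable_arrow :: "('o, 'm) cat_graph \<Rightarrow> 'm \<Rightarrow> bool" where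
  "thunkable_arrow C f \<longleftrightarrow> f \<in> Ar C \<and>
     (\<forall>g \<in> Ar C. \<forall>h \<in> Ar C. Src C g = Tgt C f \<longrightarrow> Src C h = Tgt C g \<longrightarrow>
        (h \<cdot>\<^bsub>C\<^esub> g) \<cdot>\<^bsub>C\<^esub> f = h \<cdot>\<^bsub>C\<^esub> (g \<cdot>\<^bsub>C\<^esub> f))"

definition linear_arrow :: "('o, 'm) cat_graph \<Rightarrow> 'm \<Rightarrow> bool" where
  "linear_arrow C h \<longleftrightarrow> h \<in> Ar C \<and>
     (\<forall>f \<in> Ar C. \<forall>g \<in> Ar C. Src C g = Tgt C f \<longrightarrow> Src C h = Tgt C g \<longrightarrow>
        (h \<cdot>\<^bsub>C\<^esub> g) \<cdot>\<^bsub>C\<^esub> f = h \<cdot>\<^bsub>C\<^esub> (g \<cdot>\<^bsub>C\<^esub> f))"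

definition positive_object :: "('o, 'm) cat_graph \<Rightarrow> 'o \<Rightarrow> bool" where
  "positive_object C A \<longleftrightarrow> A \<in> Ob C \<and> (\<forall>f \<in> Ar C. Src C f = A \<longrightarrow> linear_arrow C f)"

definition negative_object :: "('o, 'm) cat_graph \<Rightarrow> 'o \<Rightarrow> bool" where
  "negative_object C A \<longleftrightarrow> A \<in> Ob C \<and> (\<forall>f \<in> Ar C. Tgt C f = A \<longrightarrow> thunkable_arrow C f)"

definition Pos_thunkable :: "('o, 'm) cat_graph \<Rightarrow> ('o, 'm) cat_graph" where
  "Pos_thunkable C = C\<lparr>Ob := {A. positive_object C A},
     Ar := {f. thunkable_arrow C f \<and> positive_object C (Src C f) \<and> positive_object C (Tgt C f)}\<rparr>"

definition Neg_linear :: "('o, 'm) cat_graph \<Rightarrow> ('o, 'm) cat_graph" where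
  "Neg_linear C = C\<lparr>Ob := {A. negative_object C A},
     Ar := {f. linear_arrow C f \<and> negative_object C (Src C f) \<and> negative_object C (Tgt C f)}\<rparr>"

lemma (in nonassoc_category) category_Pos_thunkable: "category (Pos_thunkable C)"
proof -
  have id: "thunkable_arrow C (Idn C A)" if "A \<in> Ob C" for A
    unfolding thunkable_arrow_def using Idn_hom[OF that] Idn_right Cmp_hom
    by (fastforce simp: hom_def)
  have comp: "thunkable_arrow C (g \<cdot> f)"
    if f: "thunkable_arrow C f" and g: "thunkable_arrow C g" and gf: "Src C g = Tgt C f" for f g
  proof -
    have ty: "f \<in> hom C (Src C f) (Tgt C f)" "g \<in> hom C (Tgt C f) (Tgt C g)"
      using f g gf by (auto simp: thunkable_arrow_def hom_def)
    have "(k \<cdot> h) \<cdot> (g \<cdot> f) = k \<cdot> (h \<cdot> (g \<cdot> f))"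
      if h: "h \<in> hom C (Tgt C g) B" and k: "k \<in> hom C B E" for h k B E
    proof -
      have f': "(b \<cdot> a) \<cdot> f = b \<cdot> (a \<cdot> f)" if "a \<in> hom C (Tgt C f) X" "b \<in> hom C X Y" for a b X Y
        using f that by (auto simp: thunkable_arrow_def hom_def)
      have g': "(k \<cdot> h) \<cdot> g = k \<cdot> (h \<cdot> g)"
        using g h k by (auto simp: thunkable_arrow_def hom_def)
      show ?thesis
        using f'[OF ty(2) Cmp_hom[OF h k]] f'[OF ty(2) h] f'[OF Cmp_hom[OF ty(2) h] k] g' by simp
    qed
    then show ?thesis
      using Cmp_hom[OF ty] by (auto simp: thunkable_arrow_def hom_def)
  qed
  show ?thesis
  proof unfold_locales
    fix f g A B E
    assume "f \<in> hom (Pos_thunkable C) A B" "g \<in> hom (Pos_thunkable C) B E"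
    then show "g \<cdot>\<^bsub>Pos_thunkable C\<^esub> f \<in> hom (Pos_thunkable C) A E"
      using comp[of f g] Cmp_hom[of f A B g E]
      by (auto simp: Pos_thunkable_def hom_def thunkable_arrow_def)
  qed (use id Idn_hom Idn_left Idn_right in
       \<open>auto simp: Pos_thunkable_def hom_def thunkable_arrow_def positive_object_def\<close>)
qed

lemma (in nonassoc_category) category_Neg_linear: "category (Neg_linear C)"
proof -
  have id: "linear_arrow C (Idn C A)" if "A \<in> Ob C" for A
    unfolding linear_arrow_def using Idn_hom[OF that] Idn_left Cmp_hom
    by (fastforce simp: hom_def)
  have comp: "linear_arrow C (k \<cdot> h)"
    if h: "linear_arrow C h" and k: "linear_arrow C k" and kh: "Src C k = Tgt C h" for h k
  proof -
    have ty: "h \<in> hom C (Src C h) (Tgt C h)" "k \<in> hom C (Tgt C h) (Tgt C k)"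
      using h k kh by (auto simp: linear_arrow_def hom_def)
    have "((k \<cdot> h) \<cdot> g) \<cdot> f = (k \<cdot> h) \<cdot> (g \<cdot> f)"
      if f: "f \<in> hom C B E" and g: "g \<in> hom C E (Src C h)" for f g B E
    proof -
      have k': "(k \<cdot> b) \<cdot> a = k \<cdot> (b \<cdot> a)" if "a \<in> hom C X Y" "b \<in> hom C Y (Tgt C h)" for a b X Y
        using k kh that by (auto simp: linear_arrow_def hom_def)
      have h': "(h \<cdot> g) \<cdot> f = h \<cdot> (g \<cdot> f)"
        using h f g by (auto simp: linear_arrow_def hom_def)
      show ?thesis
        using k'[OF g ty(1)] k'[OF f Cmp_hom[OF g ty(1)]] k'[OF Cmp_hom[OF f g] ty(1)] h' by simp
    qed
    then show ?thesis
      using Cmp_hom[OF ty] by (auto simp: linear_arrow_def hom_def)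
  qed
  show ?thesis
  proof unfold_locales
    fix f g A B E
    assume "f \<in> hom (Neg_linear C) A B" "g \<in> hom (Neg_linear C) B E"
    then show "g \<cdot>\<^bsub>Neg_linear C\<^esub> f \<in> hom (Neg_linear C) A E"
      using comp[of f g] Cmp_hom[of f A B g E]
      by (auto simp: Neg_linear_def hom_def linear_arrow_def)
  qed (use id Idn_hom Idn_left Idn_right in
       \<open>auto simp: Neg_linear_def hom_def linear_arrow_def negative_object_def\<close>)
qed

text \<open>A map of graphs is a pair of total functions, constrained only on the carriers. Hence the
  restriction of a bare functor to a subcategory is the same record seen over smaller carriers.\<close>

record ('o, 'm, 'p, 'n) graph_map =
  on_Ob :: "'o \<Rightarrow> 'p"
  on_Ar :: "'m \<Rightarrow> 'n"

definition id_graph_map :: "('o, 'm, 'o, 'm) graph_map" where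
  "id_graph_map = \<lparr>on_Ob = (\<lambda>A. A), on_Ar = (\<lambda>f. f)\<rparr>"

locale bare_functor = C: nonassoc_category C + D: nonassoc_category D
  for C :: "('o, 'm) cat_graph" and D :: "('p, 'n) cat_graph" +
  fixes F :: "('o, 'm, 'p, 'n) graph_map"
  assumes on_Ob: "A \<in> Ob C \<Longrightarrow> on_Ob F A \<in> Ob D"
    and on_Ar: "f \<in> hom C A B \<Longrightarrow> on_Ar F f \<in> hom D (on_Ob F A) (on_Ob F B)"
    and on_Idn: "A \<in> Ob C \<Longrightarrow> on_Ar F (Idn C A) = Idn D (on_Ob F A)"

locale cat_functor = bare_functor C D F + C: category C + D: category D
  for C :: "('o, 'm) cat_graph" and D :: "('p, 'n) cat_graph"
    and F :: "('o, 'm, 'p, 'n) graph_map" +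
  assumes on_Cmp: "\<lbrakk>f \<in> hom C A B; g \<in> hom C B E\<rbrakk> \<Longrightarrow>
    on_Ar F (g \<cdot>\<^bsub>C\<^esub> f) = on_Ar F g \<cdot>\<^bsub>D\<^esub> on_Ar F f"

locale nonassoc_adjunction = F: bare_functor D E F + G: bare_functor E D G
  for D :: "('o, 'm) cat_graph" and E :: "('p, 'n) cat_graph"
    and F :: "('o, 'm, 'p, 'n) graph_map" and G :: "('p, 'n, 'o, 'm) graph_map" +
  fixes \<phi> :: "'o \<Rightarrow> 'p \<Rightarrow> 'n \<Rightarrow> 'm"
  assumes \<phi>_bij: "\<lbrakk>A \<in> Ob D; B \<in> Ob E\<rbrakk> \<Longrightarrow>
      bij_betw (\<phi> A B) (hom E (on_Ob F A) B) (hom D A (on_Ob G B))"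
    and \<phi>_natural_right: "\<lbrakk>A \<in> Ob D; h \<in> hom E (on_Ob F A) B; g \<in> hom E B B'\<rbrakk> \<Longrightarrow>
      \<phi> A B' (g \<cdot>\<^bsub>E\<^esub> h) = on_Ar G g \<cdot>\<^bsub>D\<^esub> \<phi> A B h"
    and \<phi>_natural_left: "\<lbrakk>f \<in> hom D A' A; h \<in> hom E (on_Ob F A) B\<rbrakk> \<Longrightarrow>
      \<phi> A' B (h \<cdot>\<^bsub>E\<^esub> on_Ar F f) = \<phi> A B h \<cdot>\<^bsub>D\<^esub> f"

locale positive_adjunction = nonassoc_adjunction +
  assumes left_positive: "A \<in> Ob D \<Longrightarrow> positive_object E (on_Ob F A)"

locale negative_adjunction = nonassoc_adjunction +
  assumes right_negative: "B \<in> Ob E \<Longrightarrow> negative_object D (on_Ob G B)"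

lemma (in positive_adjunction) left_adjoint_corestricts:
  assumes "category D"
  shows "cat_functor D (Pos_thunkable E) F"
proof -
  interpret D: category D by fact
  interpret P: category "Pos_thunkable E" by (rule F.D.category_Pos_thunkable)
  have inj: "x = y" if "x \<in> hom E (on_Ob F A) B" "y \<in> hom E (on_Ob F A) B" "\<phi> A B x = \<phi> A B y"
    "A \<in> Ob D" "B \<in> Ob E" for x y A B
    using \<phi>_bij[OF that(4,5)] that(1-3) by (auto simp: bij_betw_def inj_on_def)
  have \<phi>_in: "\<phi> A B x \<in> hom D A (on_Ob G B)"
    if "x \<in> hom E (on_Ob F A) B" "A \<in> Ob D" "B \<in> Ob E" for x A B
    using \<phi>_bij[OF that(2,3)] that(1) by (auto simp: bij_betw_def)
  have ob: "A \<in> Ob D" "B \<in> Ob D" if "f \<in> hom D A B" for f A B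
    using that F.C.Src_Ob F.C.Tgt_Ob by (auto simp: hom_def)
  have ob': "A \<in> Ob E" "B \<in> Ob E" if "f \<in> hom E A B" for f A B
    using that F.D.Src_Ob F.D.Tgt_Ob by (auto simp: hom_def)
  have assoc: "(h \<cdot>\<^bsub>E\<^esub> g) \<cdot>\<^bsub>E\<^esub> on_Ar F f = h \<cdot>\<^bsub>E\<^esub> (g \<cdot>\<^bsub>E\<^esub> on_Ar F f)"
    if f: "f \<in> hom D A A'" and g: "g \<in> hom E (on_Ob F A') B" and h: "h \<in> hom E B B'"
    for f g h A A' B B'
  proof -
    note A = ob[OF f] and B = ob'[OF h]
    have Ff: "on_Ar F f \<in> hom E (on_Ob F A) (on_Ob F A')" using f by (rule F.on_Ar)
    have "\<phi> A B' ((h \<cdot>\<^bsub>E\<^esub> g) \<cdot>\<^bsub>E\<^esub> on_Ar F f) = (on_Ar G h \<cdot>\<^bsub>D\<^esub> \<phi> A' B g) \<cdot>\<^bsub>D\<^esub> f"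
      by (simp add: \<phi>_natural_left[OF f F.D.Cmp_hom[OF g h]] \<phi>_natural_right[OF A(2) g h])
    also have "\<dots> = on_Ar G h \<cdot>\<^bsub>D\<^esub> (\<phi> A' B g \<cdot>\<^bsub>D\<^esub> f)"
      by (rule D.Cmp_assoc[OF f \<phi>_in[OF g A(2) B(1)] G.on_Ar[OF h]])
    also have "\<dots> = \<phi> A B' (h \<cdot>\<^bsub>E\<^esub> (g \<cdot>\<^bsub>E\<^esub> on_Ar F f))"
      by (simp add: \<phi>_natural_left[OF f g] \<phi>_natural_right[OF A(1) F.D.Cmp_hom[OF Ff g] h])
    finally show ?thesis
      by (rule inj[OF F.D.Cmp_hom[OF Ff F.D.Cmp_hom[OF g h]]
            F.D.Cmp_hom[OF F.D.Cmp_hom[OF Ff g] h] _ A(1) B(2)])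
  qed
  have cmp: "on_Ar F (g \<cdot>\<^bsub>D\<^esub> f) = on_Ar F g \<cdot>\<^bsub>E\<^esub> on_Ar F f"
    if f: "f \<in> hom D A B" and g: "g \<in> hom D B K" for f g A B K
  proof -
    let ?i = "Idn E (on_Ob F K)"
    have K: "on_Ob F K \<in> Ob E" using ob(2)[OF g] by (rule F.on_Ob)
    note i = F.D.Idn_hom[OF K] and gf = F.C.Cmp_hom[OF f g]
    note F = F.on_Ar[OF f] F.on_Ar[OF g] F.on_Ar[OF gf]
    have "\<phi> A (on_Ob F K) (on_Ar F (g \<cdot>\<^bsub>D\<^esub> f)) = \<phi> K (on_Ob F K) ?i \<cdot>\<^bsub>D\<^esub> (g \<cdot>\<^bsub>D\<^esub> f)"
      using \<phi>_natural_left[OF gf i] F.D.Idn_left[OF F(3)] by simp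
    also have "\<dots> = (\<phi> K (on_Ob F K) ?i \<cdot>\<^bsub>D\<^esub> g) \<cdot>\<^bsub>D\<^esub> f"
      by (rule D.Cmp_assoc[OF f g \<phi>_in[OF i ob(2)[OF g] K], symmetric])
    also have "\<dots> = \<phi> A (on_Ob F K) (on_Ar F g \<cdot>\<^bsub>E\<^esub> on_Ar F f)"
      using \<phi>_natural_left[OF g i] \<phi>_natural_left[OF f F(2)] F.D.Idn_left[OF F(2)] by simp
    finally show ?thesis
      by (rule inj[OF F(3) F.D.Cmp_hom[OF F(1,2)] _ ob(1)[OF f] K])
  qed
  have thunk: "thunkable_arrow E (on_Ar F f)" if "f \<in> hom D A B" for f A B
    using F.on_Ar[OF that] assoc[OF that] by (auto simp: thunkable_arrow_def hom_def)
  show ?thesis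
  proof unfold_locales
    fix f A B assume f: "f \<in> hom D A B"
    show "on_Ar F f \<in> hom (Pos_thunkable E) (on_Ob F A) (on_Ob F B)"
      using F.on_Ar[OF f] thunk[OF f] left_positive ob[OF f]
      by (auto simp: Pos_thunkable_def hom_def)
  qed (use left_positive cmp F.on_Idn in \<open>auto simp: Pos_thunkable_def\<close>)
qed

record ('o, 'm) monoidal_data =
  ten_Ob :: "'o \<Rightarrow> 'o \<Rightarrow> 'o" (infixr "\<otimes>\<index>" 75)
  ten_Ar :: "'m \<Rightarrow> 'm \<Rightarrow> 'm" (infixr "\<boxtimes>\<index>" 75)
  unit_Ob :: "'o"
  assoc :: "'o \<Rightarrow> 'o \<Rightarrow> 'o \<Rightarrow> 'm"
  lunit :: "'o \<Rightarrow> 'm"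
  runit :: "'o \<Rightarrow> 'm"
  braid :: "'o \<Rightarrow> 'o \<Rightarrow> 'm"

locale symmetric_monoidal_category = category C
  for C :: "('o, 'm) cat_graph" (structure) and S :: "('o, 'm) monoidal_data" (structure) +
  assumes ten_Ob: "\<lbrakk>X \<in> Ob C; Y \<in> Ob C\<rbrakk> \<Longrightarrow> X \<otimes>\<^bsub>S\<^esub> Y \<in> Ob C"
    and unit_Ob: "unit_Ob S \<in> Ob C"
    and ten_Ar: "\<lbrakk>f \<in> hom C X X'; g \<in> hom C Y Y'\<rbrakk> \<Longrightarrow>
      f \<boxtimes>\<^bsub>S\<^esub> g \<in> hom C (X \<otimes>\<^bsub>S\<^esub> Y) (X' \<otimes>\<^bsub>S\<^esub> Y')"
    and ten_Idn: "\<lbrakk>X \<in> Ob C; Y \<in> Ob C\<rbrakk> \<Longrightarrow> Idn C X \<boxtimes>\<^bsub>S\<^esub> Idn C Y = Idn C (X \<otimes>\<^bsub>S\<^esub> Y)"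
    and ten_Cmp: "\<lbrakk>f \<in> hom C X X'; f' \<in> hom C X' X''; g \<in> hom C Y Y'; g' \<in> hom C Y' Y''\<rbrakk> \<Longrightarrow>
      (f' \<cdot>\<^bsub>C\<^esub> f) \<boxtimes>\<^bsub>S\<^esub> (g' \<cdot>\<^bsub>C\<^esub> g) = (f' \<boxtimes>\<^bsub>S\<^esub> g') \<cdot>\<^bsub>C\<^esub> (f \<boxtimes>\<^bsub>S\<^esub> g)"
    and assoc_iso: "\<lbrakk>X \<in> Ob C; Y \<in> Ob C; Z \<in> Ob C\<rbrakk> \<Longrightarrow>
      iso_arrow C ((X \<otimes>\<^bsub>S\<^esub> Y) \<otimes>\<^bsub>S\<^esub> Z) (X \<otimes>\<^bsub>S\<^esub> (Y \<otimes>\<^bsub>S\<^esub> Z)) (assoc S X Y Z)"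
    and lunit_iso: "X \<in> Ob C \<Longrightarrow> iso_arrow C (unit_Ob S \<otimes>\<^bsub>S\<^esub> X) X (lunit S X)"
    and runit_iso: "X \<in> Ob C \<Longrightarrow> iso_arrow C (X \<otimes>\<^bsub>S\<^esub> unit_Ob S) X (runit S X)"
    and braid_hom: "\<lbrakk>X \<in> Ob C; Y \<in> Ob C\<rbrakk> \<Longrightarrow> braid S X Y \<in> hom C (X \<otimes>\<^bsub>S\<^esub> Y) (Y \<otimes>\<^bsub>S\<^esub> X)"
    and assoc_natural: "\<lbrakk>f \<in> hom C X X'; g \<in> hom C Y Y'; h \<in> hom C Z Z'\<rbrakk> \<Longrightarrow>
      assoc S X' Y' Z' \<cdot>\<^bsub>C\<^esub> ((f \<boxtimes>\<^bsub>S\<^esub> g) \<boxtimes>\<^bsub>S\<^esub> h) = (f \<boxtimes>\<^bsub>S\<^esub> (g \<boxtimes>\<^bsub>S\<^esub> h)) \<cdot>\<^bsub>C\<^esub> assoc S X Y Z"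
    and lunit_natural: "f \<in> hom C X X' \<Longrightarrow>
      lunit S X' \<cdot>\<^bsub>C\<^esub> (Idn C (unit_Ob S) \<boxtimes>\<^bsub>S\<^esub> f) = f \<cdot>\<^bsub>C\<^esub> lunit S X"
    and runit_natural: "f \<in> hom C X X' \<Longrightarrow>
      runit S X' \<cdot>\<^bsub>C\<^esub> (f \<boxtimes>\<^bsub>S\<^esub> Idn C (unit_Ob S)) = f \<cdot>\<^bsub>C\<^esub> runit S X"
    and braid_natural: "\<lbrakk>f \<in> hom C X X'; g \<in> hom C Y Y'\<rbrakk> \<Longrightarrow>
      braid S X' Y' \<cdot>\<^bsub>C\<^esub> (f \<boxtimes>\<^bsub>S\<^esub> g) = (g \<boxtimes>\<^bsub>S\<^esub> f) \<cdot>\<^bsub>C\<^esub> braid S X Y"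
    and pentagon: "\<lbrakk>W \<in> Ob C; X \<in> Ob C; Y \<in> Ob C; Z \<in> Ob C\<rbrakk> \<Longrightarrow>
      assoc S W X (Y \<otimes>\<^bsub>S\<^esub> Z) \<cdot>\<^bsub>C\<^esub> assoc S (W \<otimes>\<^bsub>S\<^esub> X) Y Z =
      (Idn C W \<boxtimes>\<^bsub>S\<^esub> assoc S X Y Z) \<cdot>\<^bsub>C\<^esub>
        (assoc S W (X \<otimes>\<^bsub>S\<^esub> Y) Z \<cdot>\<^bsub>C\<^esub> (assoc S W X Y \<boxtimes>\<^bsub>S\<^esub> Idn C Z))"
    and triangle: "\<lbrakk>X \<in> Ob C; Y \<in> Ob C\<rbrakk> \<Longrightarrow>
      (Idn C X \<boxtimes>\<^bsub>S\<^esub> lunit S Y) \<cdot>\<^bsub>C\<^esub> assoc S X (unit_Ob S) Y = runit S X \<boxtimes>\<^bsub>S\<^esub> Idn C Y"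
    and hexagon: "\<lbrakk>X \<in> Ob C; Y \<in> Ob C; Z \<in> Ob C\<rbrakk> \<Longrightarrow>
      assoc S Y Z X \<cdot>\<^bsub>C\<^esub> (braid S X (Y \<otimes>\<^bsub>S\<^esub> Z) \<cdot>\<^bsub>C\<^esub> assoc S X Y Z) =
      (Idn C Y \<boxtimes>\<^bsub>S\<^esub> braid S X Z) \<cdot>\<^bsub>C\<^esub>
        (assoc S Y X Z \<cdot>\<^bsub>C\<^esub> (braid S X Y \<boxtimes>\<^bsub>S\<^esub> Idn C Z))"
    and braid_symmetric: "\<lbrakk>X \<in> Ob C; Y \<in> Ob C\<rbrakk> \<Longrightarrow>
      braid S Y X \<cdot>\<^bsub>C\<^esub> braid S X Y = Idn C (X \<otimes>\<^bsub>S\<^esub> Y)"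

record ('o, 'm) product_data =
  terminal :: "'o"
  prod_Ob :: "'o \<Rightarrow> 'o \<Rightarrow> 'o"
  proj1 :: "'o \<Rightarrow> 'o \<Rightarrow> 'm"
  proj2 :: "'o \<Rightarrow> 'o \<Rightarrow> 'm"

locale cartesian_category = category C
  for C :: "('o, 'm) cat_graph" (structure) and K :: "('o, 'm) product_data" +
  assumes terminal_Ob: "terminal K \<in> Ob C"
    and terminal_universal: "X \<in> Ob C \<Longrightarrow> \<exists>!f. f \<in> hom C X (terminal K)"
    and prod_Ob: "\<lbrakk>X \<in> Ob C; Y \<in> Ob C\<rbrakk> \<Longrightarrow> prod_Ob K X Y \<in> Ob C"
    and proj1_hom: "\<lbrakk>X \<in> Ob C; Y \<in> Ob C\<rbrakk> \<Longrightarrow> proj1 K X Y \<in> hom C (prod_Ob K X Y) X"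
    and proj2_hom: "\<lbrakk>X \<in> Ob C; Y \<in> Ob C\<rbrakk> \<Longrightarrow> proj2 K X Y \<in> hom C (prod_Ob K X Y) Y"
    and prod_universal: "\<lbrakk>f \<in> hom C Z X; g \<in> hom C Z Y\<rbrakk> \<Longrightarrow>
      \<exists>!h. h \<in> hom C Z (prod_Ob K X Y) \<and> proj1 K X Y \<cdot> h = f \<and> proj2 K X Y \<cdot> h = g"

definition pairing :: "('o, 'm) cat_graph \<Rightarrow> ('o, 'm) product_data \<Rightarrow> 'm \<Rightarrow> 'm \<Rightarrow> 'm" where
  "pairing C K f g = (THE h. h \<in> hom C (Src C f) (prod_Ob K (Tgt C f) (Tgt C g)) \<and>
     proj1 K (Tgt C f) (Tgt C g) \<cdot>\<^bsub>C\<^esub> h = f \<and> proj2 K (Tgt C f) (Tgt C g) \<cdot>\<^bsub>C\<^esub> h = g)"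

definition cartesian_monoidal ::
    "('o, 'm) cat_graph \<Rightarrow> ('o, 'm) product_data \<Rightarrow> ('o, 'm) monoidal_data" where
  "cartesian_monoidal C K = \<lparr>
     ten_Ob = prod_Ob K,
     ten_Ar = (\<lambda>f g. pairing C K (f \<cdot>\<^bsub>C\<^esub> proj1 K (Src C f) (Src C g))
                                 (g \<cdot>\<^bsub>C\<^esub> proj2 K (Src C f) (Src C g))),
     unit_Ob = terminal K,
     assoc = (\<lambda>X Y Z. pairing C K
       (proj1 K X Y \<cdot>\<^bsub>C\<^esub> proj1 K (prod_Ob K X Y) Z)
       (pairing C K (proj2 K X Y \<cdot>\<^bsub>C\<^esub> proj1 K (prod_Ob K X Y) Z) (proj2 K (prod_Ob K X Y) Z))),
     lunit = (\<lambda>X. proj2 K (terminal K) X),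
     runit = (\<lambda>X. proj1 K X (terminal K)),
     braid = (\<lambda>X Y. pairing C K (proj2 K X Y) (proj1 K X Y))\<rparr>"

locale strong_monoidal_functor = cat_functor C D F
  for C :: "('o, 'm) cat_graph" and T :: "('o, 'm) monoidal_data"
    and D :: "('p, 'n) cat_graph" and S :: "('p, 'n) monoidal_data"
    and F :: "('o, 'm, 'p, 'n) graph_map" +
  fixes \<mu> :: "'o \<Rightarrow> 'o \<Rightarrow> 'n" and \<eta> :: "'n"
  assumes \<mu>_iso: "\<lbrakk>X \<in> Ob C; Y \<in> Ob C\<rbrakk> \<Longrightarrow>
      iso_arrow D (on_Ob F X \<otimes>\<^bsub>S\<^esub> on_Ob F Y) (on_Ob F (X \<otimes>\<^bsub>T\<^esub> Y)) (\<mu> X Y)"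
    and \<eta>_iso: "iso_arrow D (unit_Ob S) (on_Ob F (unit_Ob T)) \<eta>"
    and \<mu>_natural: "\<lbrakk>f \<in> hom C X X'; g \<in> hom C Y Y'\<rbrakk> \<Longrightarrow>
      \<mu> X' Y' \<cdot>\<^bsub>D\<^esub> (on_Ar F f \<boxtimes>\<^bsub>S\<^esub> on_Ar F g) = on_Ar F (f \<boxtimes>\<^bsub>T\<^esub> g) \<cdot>\<^bsub>D\<^esub> \<mu> X Y"
    and \<mu>_assoc: "\<lbrakk>X \<in> Ob C; Y \<in> Ob C; Z \<in> Ob C\<rbrakk> \<Longrightarrow>
      on_Ar F (assoc T X Y Z) \<cdot>\<^bsub>D\<^esub> (\<mu> (X \<otimes>\<^bsub>T\<^esub> Y) Z \<cdot>\<^bsub>D\<^esub> (\<mu> X Y \<boxtimes>\<^bsub>S\<^esub> Idn D (on_Ob F Z))) =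
      \<mu> X (Y \<otimes>\<^bsub>T\<^esub> Z) \<cdot>\<^bsub>D\<^esub> ((Idn D (on_Ob F X) \<boxtimes>\<^bsub>S\<^esub> \<mu> Y Z) \<cdot>\<^bsub>D\<^esub>
        assoc S (on_Ob F X) (on_Ob F Y) (on_Ob F Z))"
    and \<mu>_lunit: "X \<in> Ob C \<Longrightarrow>
      on_Ar F (lunit T X) \<cdot>\<^bsub>D\<^esub> (\<mu> (unit_Ob T) X \<cdot>\<^bsub>D\<^esub> (\<eta> \<boxtimes>\<^bsub>S\<^esub> Idn D (on_Ob F X))) =
      lunit S (on_Ob F X)"
    and \<mu>_runit: "X \<in> Ob C \<Longrightarrow>
      on_Ar F (runit T X) \<cdot>\<^bsub>D\<^esub> (\<mu> X (unit_Ob T) \<cdot>\<^bsub>D\<^esub> (Idn D (on_Ob F X) \<boxtimes>\<^bsub>S\<^esub> \<eta>)) =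
      runit S (on_Ob F X)"

locale duploid = nonassoc_category D +
  shift_down: positive_adjunction D D Down id_graph_map \<phi>_down +
  shift_up: negative_adjunction D D id_graph_map Up \<phi>_up
  for D :: "('o, 'm) cat_graph"
    and Down :: "('o, 'm, 'o, 'm) graph_map" and \<phi>_down :: "'o \<Rightarrow> 'o \<Rightarrow> 'm \<Rightarrow> 'm"
    and Up :: "('o, 'm, 'o, 'm) graph_map" and \<phi>_up :: "'o \<Rightarrow> 'o \<Rightarrow> 'm \<Rightarrow> 'm" +
  assumes polarised: "A \<in> Ob D \<Longrightarrow> positive_object D A \<or> negative_object D A"

text \<open>Of the tensor product of a symmetric monoidal duploid, only the symmetric monoidal structure
  it induces on positive objects and thunkable morphisms is recorded. Every symmetric monoidal
  duploid gives an instance of this locale.\<close>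

locale symmetric_monoidal_duploid = duploid D Down \<phi>_down Up \<phi>_up +
  positives: symmetric_monoidal_category "Pos_thunkable D" S
  for D :: "('o, 'm) cat_graph"
    and Down :: "('o, 'm, 'o, 'm) graph_map" and \<phi>_down :: "'o \<Rightarrow> 'o \<Rightarrow> 'm \<Rightarrow> 'm"
    and Up :: "('o, 'm, 'o, 'm) graph_map" and \<phi>_up :: "'o \<Rightarrow> 'o \<Rightarrow> 'm \<Rightarrow> 'm"
    and S :: "('o, 'm) monoidal_data"

text \<open>By \<open>left_adjoint_corestricts\<close>, the functoriality of \<open>Lin\<close> contained in
  \<open>strong_monoidal_functor\<close> is no additional assumption here.\<close>

locale direct_lnl_adjunction = positive_adjunction M D Lin Mult \<phi> + cartesian_category M K +
  Lin: strong_monoidal_functor M "cartesian_monoidal M K" "Pos_thunkable D" S Lin \<mu> \<eta>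
  for M :: "('x, 'u) cat_graph" and K :: "('x, 'u) product_data"
    and D :: "('o, 'm) cat_graph" and S :: "('o, 'm) monoidal_data"
    and Lin :: "('x, 'u, 'o, 'm) graph_map" and \<mu> :: "'x \<Rightarrow> 'x \<Rightarrow> 'm" and \<eta> :: "'m"
    and Mult :: "('o, 'm, 'x, 'u) graph_map" and \<phi> :: "'x \<Rightarrow> 'o \<Rightarrow> 'm \<Rightarrow> 'u"

locale relative_lnl_coadjunction =
  base: symmetric_monoidal_category A S + R: cat_functor B A R +
  cartesian_category M K +
  Lin: strong_monoidal_functor M "cartesian_monoidal M K" A S Lin \<mu> \<eta> +
  Mult: cat_functor B M Mult
  for A :: "('o, 'm) cat_graph" and S :: "('o, 'm) monoidal_data"
    and B :: "('p, 'n) cat_graph" and R :: "('p, 'n, 'o, 'm) graph_map"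
    and M :: "('x, 'u) cat_graph" and K :: "('x, 'u) product_data"
    and Lin :: "('x, 'u, 'o, 'm) graph_map" and \<mu> :: "'x \<Rightarrow> 'x \<Rightarrow> 'm" and \<eta> :: "'m"
    and Mult :: "('p, 'n, 'x, 'u) graph_map" +
  fixes \<psi> :: "'x \<Rightarrow> 'p \<Rightarrow> 'm \<Rightarrow> 'u"
  assumes \<psi>_bij: "\<lbrakk>X \<in> Ob M; N \<in> Ob B\<rbrakk> \<Longrightarrow>
      bij_betw (\<psi> X N) (hom A (on_Ob Lin X) (on_Ob R N)) (hom M X (on_Ob Mult N))"
    and \<psi>_natural_left: "\<lbrakk>u \<in> hom M X' X; N \<in> Ob B; f \<in> hom A (on_Ob Lin X) (on_Ob R N)\<rbrakk> \<Longrightarrow>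
      \<psi> X' N (f \<cdot>\<^bsub>A\<^esub> on_Ar Lin u) = \<psi> X N f \<cdot>\<^bsub>M\<^esub> u"
    and \<psi>_natural_right: "\<lbrakk>X \<in> Ob M; g \<in> hom B N N'; f \<in> hom A (on_Ob Lin X) (on_Ob R N)\<rbrakk> \<Longrightarrow>
      \<psi> X N' (on_Ar R g \<cdot>\<^bsub>A\<^esub> f) = on_Ar Mult g \<cdot>\<^bsub>M\<^esub> \<psi> X N f"

end

theory Submission
  imports Defs
begin

text \<open>The counit \<open>\<epsilon>\<^sub>N : \<Down>N \<rightarrow> N\<close> of the down shift has a thunkable inverse \<open>w\<^sub>N\<close>. Since \<open>N\<close> is negative,
  every morphism \<open>f\<close> into it is thunkable, and so is \<open>w\<^sub>N \<circ> f\<close>. Hence composition with \<open>\<epsilon>\<^sub>N\<close> is a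
  bijection from thunkable maps \<open>P \<rightarrow> \<Down>N\<close> to all maps \<open>P \<rightarrow> N\<close>, and
  \<open>\<psi>(f) = \<phi>(\<epsilon>\<^sub>N \<circ> f)\<close>.\<close>

section \<open>Thunkable and linear morphisms in terms of typed hom-sets\<close>

lemma thunkable_arrowD:
  "\<lbrakk>thunkable_arrow C f; f \<in> hom C X A; g \<in> hom C A B; h \<in> hom C B E\<rbrakk> \<Longrightarrow>
    (h \<cdot>\<^bsub>C\<^esub> g) \<cdot>\<^bsub>C\<^esub> f = h \<cdot>\<^bsub>C\<^esub> (g \<cdot>\<^bsub>C\<^esub> f)"
  by (auto simp: thunkable_arrow_def hom_def)

lemma linear_arrowD:
  "\<lbrakk>linear_arrow C h; f \<in> hom C X A; g \<in> hom C A B; h \<in> hom C B E\<rbrakk> \<Longrightarrow>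
    (h \<cdot>\<^bsub>C\<^esub> g) \<cdot>\<^bsub>C\<^esub> f = h \<cdot>\<^bsub>C\<^esub> (g \<cdot>\<^bsub>C\<^esub> f)"
  by (auto simp: linear_arrow_def hom_def)

lemma thunkable_arrowI:
  assumes "f \<in> hom C X A"
    and "\<And>g h B E. \<lbrakk>g \<in> hom C A B; h \<in> hom C B E\<rbrakk> \<Longrightarrow>
      (h \<cdot>\<^bsub>C\<^esub> g) \<cdot>\<^bsub>C\<^esub> f = h \<cdot>\<^bsub>C\<^esub> (g \<cdot>\<^bsub>C\<^esub> f)"
  shows "thunkable_arrow C f"
  using assms by (auto simp: thunkable_arrow_def hom_def)

lemma negative_objectD:
  "\<lbrakk>negative_object C N; f \<in> hom C A N\<rbrakk> \<Longrightarrow> thunkable_arrow C f"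
  by (auto simp: negative_object_def hom_def)

lemma hom_Pos_thunkable:
  "f \<in> hom (Pos_thunkable C) A B \<longleftrightarrow>
    f \<in> hom C A B \<and> thunkable_arrow C f \<and> positive_object C A \<and> positive_object C B"
  by (auto simp: Pos_thunkable_def hom_def thunkable_arrow_def)

lemma hom_Neg_linear:
  "f \<in> hom (Neg_linear C) A B \<longleftrightarrow>
    f \<in> hom C A B \<and> linear_arrow C f \<and> negative_object C A \<and> negative_object C B"
  by (auto simp: Neg_linear_def hom_def linear_arrow_def)

lemma Pos_thunkable_simps [simp]:
  "Ob (Pos_thunkable C) = {A. positive_object C A}"
  "Idn (Pos_thunkable C) = Idn C" "Cmp (Pos_thunkable C) = Cmp C"
  by (simp_all add: Pos_thunkable_def)

lemma Neg_linear_simps [simp]: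
  "Ob (Neg_linear C) = {A. negative_object C A}"
  "Idn (Neg_linear C) = Idn C" "Cmp (Neg_linear C) = Cmp C"
  by (simp_all add: Neg_linear_def)

context nonassoc_category
begin

lemma hom_Ob:
  assumes "f \<in> hom C A B"
  shows "A \<in> Ob C" "B \<in> Ob C"
  using assms Src_Ob Tgt_Ob by (auto simp: hom_def)

text \<open>Stated for arbitrary objects because the composite
  \<open>P \<rightarrow> N \<rightarrow> \<Down>N\<close> formed later passes through an object
  \<open>N\<close> known only to be negative, outside the reach of
  \<open>category_Pos_thunkable\<close>.\<close>

lemma thunkable_Cmp:
  assumes f: "f \<in> hom C A B" "thunkable_arrow C f"
    and g: "g \<in> hom C B E" "thunkable_arrow C g"
  shows "thunkable_arrow C (g \<cdot> f)"
proof (rule thunkable_arrowI[OF Cmp_hom[OF f(1) g(1)]])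
  fix h k X Y assume h: "h \<in> hom C E X" and k: "k \<in> hom C X Y"
  show "(k \<cdot> h) \<cdot> (g \<cdot> f) = k \<cdot> (h \<cdot> (g \<cdot> f))"
    using thunkable_arrowD[OF f(2,1) g(1) Cmp_hom[OF h k]] thunkable_arrowD[OF g(2,1) h k]
      thunkable_arrowD[OF f(2,1) Cmp_hom[OF g(1) h] k] thunkable_arrowD[OF f(2,1) g(1) h]
    by simp
qed

end

section \<open>Units, counits and partial functoriality of adjoints\<close>

context nonassoc_adjunction
begin

lemma \<phi>_hom: "\<lbrakk>A \<in> Ob D; h \<in> hom E (on_Ob F A) B\<rbrakk> \<Longrightarrow> \<phi> A B h \<in> hom D A (on_Ob G B)"
  using \<phi>_bij F.D.hom_Ob(2) by (fastforce simp: bij_betw_def)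

lemma \<phi>_inject:
  assumes "\<phi> A B x = \<phi> A B y" "A \<in> Ob D" "x \<in> hom E (on_Ob F A) B" "y \<in> hom E (on_Ob F A) B"
  shows "x = y"
  using \<phi>_bij[OF assms(2) F.D.hom_Ob(2)[OF assms(3)]] assms
  by (auto simp: bij_betw_def inj_on_def)

definition counit :: "'p \<Rightarrow> 'n" where
  "counit B = inv_into (hom E (on_Ob F (on_Ob G B)) B) (\<phi> (on_Ob G B) B) (Idn D (on_Ob G B))"

lemma
  assumes "B \<in> Ob E"
  shows counit_hom: "counit B \<in> hom E (on_Ob F (on_Ob G B)) B"
    and \<phi>_counit: "\<phi> (on_Ob G B) B (counit B) = Idn D (on_Ob G B)"
proof -
  note G = G.on_Ob[OF assms]
  have "Idn D (on_Ob G B) \<in> \<phi> (on_Ob G B) B ` hom E (on_Ob F (on_Ob G B)) B"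
    using \<phi>_bij[OF G assms] F.C.Idn_hom[OF G] by (simp add: bij_betw_def)
  then show "counit B \<in> hom E (on_Ob F (on_Ob G B)) B"
    and "\<phi> (on_Ob G B) B (counit B) = Idn D (on_Ob G B)"
    unfolding counit_def by (rule inv_into_into, rule f_inv_into_f)
qed

definition unit :: "'o \<Rightarrow> 'm" where
  "unit A = \<phi> A (on_Ob F A) (Idn E (on_Ob F A))"

lemma unit_hom: "A \<in> Ob D \<Longrightarrow> unit A \<in> hom D A (on_Ob G (on_Ob F A))"
  unfolding unit_def by (rule \<phi>_hom) (auto intro: F.D.Idn_hom F.on_Ob)

text \<open>Left naturality at an identity. It turns questions about \<open>F\<close> into questions
  about brackets in \<open>D\<close>.\<close>

lemma \<phi>_on_Ar:
  assumes f: "f \<in> hom D A A'"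
  shows "\<phi> A (on_Ob F A') (on_Ar F f) = unit A' \<cdot>\<^bsub>D\<^esub> f"
  using \<phi>_natural_left[OF f F.D.Idn_hom[OF F.on_Ob[OF F.C.hom_Ob(2)[OF f]]]]
    F.D.Idn_left[OF F.on_Ar[OF f]]
  by (simp add: unit_def)

text \<open>Right naturality at the counit, whose transpose is an identity. It expresses
  \<open>G\<close> through \<open>\<phi>\<close>.\<close>

lemma \<phi>_Cmp_counit:
  assumes f: "f \<in> hom E B B'"
  shows "\<phi> (on_Ob G B) B' (f \<cdot>\<^bsub>E\<^esub> counit B) = on_Ar G f"
proof -
  note B = F.D.hom_Ob(1)[OF f]
  show ?thesis
    using \<phi>_natural_right[OF G.on_Ob[OF B] counit_hom[OF B] f] F.C.Idn_right[OF G.on_Ar[OF f]]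
    by (simp add: \<phi>_counit[OF B])
qed

text \<open>Transposing both bracketings leaves a triple in \<open>D\<close> ending in
  \<open>f\<close>, which reassociates since \<open>f\<close> is thunkable. Unlike in
  \<open>left_adjoint_corestricts\<close>, \<open>D\<close> may be non-associative, as it is for the
  down shift.\<close>

lemma left_adjoint_thunkable:
  assumes f: "f \<in> hom D A A'" "thunkable_arrow D f"
  shows "thunkable_arrow E (on_Ar F f)"
proof (rule thunkable_arrowI[OF F.on_Ar[OF f(1)]])
  fix g h B B' assume g: "g \<in> hom E (on_Ob F A') B" and h: "h \<in> hom E B B'"
  note A = F.C.hom_Ob[OF f(1)] and Ff = F.on_Ar[OF f(1)]
  have "\<phi> A B' ((h \<cdot>\<^bsub>E\<^esub> g) \<cdot>\<^bsub>E\<^esub> on_Ar F f) = (on_Ar G h \<cdot>\<^bsub>D\<^esub> \<phi> A' B g) \<cdot>\<^bsub>D\<^esub> f"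
    by (simp add: \<phi>_natural_left[OF f(1) F.D.Cmp_hom[OF g h]] \<phi>_natural_right[OF A(2) g h])
  also have "\<dots> = on_Ar G h \<cdot>\<^bsub>D\<^esub> (\<phi> A' B g \<cdot>\<^bsub>D\<^esub> f)"
    by (rule thunkable_arrowD[OF f(2,1) \<phi>_hom[OF A(2) g] G.on_Ar[OF h]])
  also have "\<dots> = \<phi> A B' (h \<cdot>\<^bsub>E\<^esub> (g \<cdot>\<^bsub>E\<^esub> on_Ar F f))"
    by (simp add: \<phi>_natural_left[OF f(1) g] \<phi>_natural_right[OF A(1) F.D.Cmp_hom[OF Ff g] h])
  finally show "(h \<cdot>\<^bsub>E\<^esub> g) \<cdot>\<^bsub>E\<^esub> on_Ar F f = h \<cdot>\<^bsub>E\<^esub> (g \<cdot>\<^bsub>E\<^esub> on_Ar F f)"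
    by (rule \<phi>_inject[OF _ A(1) F.D.Cmp_hom[OF Ff F.D.Cmp_hom[OF g h]]
          F.D.Cmp_hom[OF F.D.Cmp_hom[OF Ff g] h]])
qed

text \<open>The transposes of the two sides are the two bracketings of \<open>unit K\<close>,
  \<open>g\<close> and \<open>f\<close>, which agree since \<open>f\<close> is thunkable.\<close>

lemma left_adjoint_Cmp:
  assumes f: "f \<in> hom D A B" "thunkable_arrow D f" and g: "g \<in> hom D B K"
  shows "on_Ar F (g \<cdot>\<^bsub>D\<^esub> f) = on_Ar F g \<cdot>\<^bsub>E\<^esub> on_Ar F f"
proof (rule \<phi>_inject)
  note gf = F.C.Cmp_hom[OF f(1) g] and K = F.C.hom_Ob(2)[OF g]
  show "\<phi> A (on_Ob F K) (on_Ar F (g \<cdot>\<^bsub>D\<^esub> f)) = \<phi> A (on_Ob F K) (on_Ar F g \<cdot>\<^bsub>E\<^esub> on_Ar F f)"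
    by (simp add: \<phi>_on_Ar[OF gf] \<phi>_on_Ar[OF g] \<phi>_natural_left[OF f(1) F.on_Ar[OF g]]
        thunkable_arrowD[OF f(2,1) g unit_hom[OF K]])
  show "A \<in> Ob D" using F.C.hom_Ob(1)[OF f(1)] .
  show "on_Ar F (g \<cdot>\<^bsub>D\<^esub> f) \<in> hom E (on_Ob F A) (on_Ob F K)" using F.on_Ar[OF gf] .
  show "on_Ar F g \<cdot>\<^bsub>E\<^esub> on_Ar F f \<in> hom E (on_Ob F A) (on_Ob F K)"
    using F.D.Cmp_hom[OF F.on_Ar[OF f(1)] F.on_Ar[OF g]] .
qed

text \<open>Linearity of \<open>g\<close> rebrackets \<open>g\<close>, \<open>f\<close> and the
  counit; right naturality then pulls \<open>g\<close> out of the transpose.\<close>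

lemma right_adjoint_Cmp:
  assumes f: "f \<in> hom E A B" and g: "g \<in> hom E B K" "linear_arrow E g"
  shows "on_Ar G (g \<cdot>\<^bsub>E\<^esub> f) = on_Ar G g \<cdot>\<^bsub>D\<^esub> on_Ar G f"
proof -
  note A = F.D.hom_Ob(1)[OF f]
  note c = counit_hom[OF A]
  have "on_Ar G (g \<cdot>\<^bsub>E\<^esub> f) = \<phi> (on_Ob G A) K (g \<cdot>\<^bsub>E\<^esub> (f \<cdot>\<^bsub>E\<^esub> counit A))"
    by (simp flip: \<phi>_Cmp_counit[OF F.D.Cmp_hom[OF f g(1)]] linear_arrowD[OF g(2) c f g(1)])
  also have "\<dots> = on_Ar G g \<cdot>\<^bsub>D\<^esub> on_Ar G f"
    by (simp add: \<phi>_natural_right[OF G.on_Ob[OF A] F.D.Cmp_hom[OF c f] g(1)] \<phi>_Cmp_counit[OF f])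
  finally show ?thesis .
qed

lemma right_adjoint_restricts:
  assumes "category D"
  shows "cat_functor (Neg_linear E) D G"
proof -
  interpret D: category D by fact
  interpret N: category "Neg_linear E" by (rule F.D.category_Neg_linear)
  show ?thesis
    by unfold_locales
      (auto simp: hom_Neg_linear negative_object_def intro: G.on_Ob G.on_Ar G.on_Idn right_adjoint_Cmp)
qed

end

text \<open>Arrows into negative objects are thunkable, so \<open>F\<close> preserves their
  composites and their thunkability.\<close>

lemma (in positive_adjunction) left_adjoint_restricts:
  "cat_functor (Neg_linear D) (Pos_thunkable E) F"
proof -
  interpret N: category "Neg_linear D" by (rule F.C.category_Neg_linear)
  interpret P: category "Pos_thunkable E" by (rule F.D.category_Pos_thunkable)
  have ob: "A \<in> Ob D" if "negative_object D A" for A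
    using that by (simp add: negative_object_def)
  show ?thesis
    by unfold_locales
      (auto simp: hom_Neg_linear hom_Pos_thunkable ob
        intro: left_positive F.on_Ar F.on_Idn left_adjoint_thunkable left_adjoint_Cmp
          negative_objectD)
qed

section \<open>The down shift: its unit and counit are mutually inverse\<close>

locale positive_shift = positive_adjunction D D F id_graph_map \<phi>
  for D :: "('o, 'm) cat_graph" (structure)
    and F :: "('o, 'm, 'o, 'm) graph_map" and \<phi> :: "'o \<Rightarrow> 'o \<Rightarrow> 'm \<Rightarrow> 'm"
begin

lemma shift_counit_hom: "A \<in> Ob D \<Longrightarrow> counit A \<in> hom D (on_Ob F A) A"
  using counit_hom by (simp add: id_graph_map_def)

lemma shift_unit_hom: "A \<in> Ob D \<Longrightarrow> unit A \<in> hom D A (on_Ob F A)"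
  using unit_hom by (simp add: id_graph_map_def)

text \<open>As the right adjoint is the identity, right naturality at an identity makes
  transposition a precomposition.\<close>

lemma \<phi>_eq_Cmp_unit:
  assumes A: "A \<in> Ob D" and h: "h \<in> hom D (on_Ob F A) B"
  shows "\<phi> A B h = h \<cdot> unit A"
  using \<phi>_natural_right[OF A F.C.Idn_hom[OF F.on_Ob[OF A]] h] F.C.Idn_right[OF h]
  by (simp add: unit_def id_graph_map_def)

text \<open>With \<open>\<phi>\<close> read as precomposition with the unit, right naturality is
  literally the required associativity.\<close>

lemma unit_thunkable:
  assumes A: "A \<in> Ob D"
  shows "thunkable_arrow D (unit A)"
proof (rule thunkable_arrowI[OF shift_unit_hom[OF A]])
  fix g h B E assume g: "g \<in> hom D (on_Ob F A) B" and h: "h \<in> hom D B E"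
  show "(h \<cdot> g) \<cdot> unit A = h \<cdot> (g \<cdot> unit A)"
    using \<phi>_natural_right[OF A g h]
    by (simp add: \<phi>_eq_Cmp_unit[OF A g] \<phi>_eq_Cmp_unit[OF A F.C.Cmp_hom[OF g h]] id_graph_map_def)
qed

lemma counit_Cmp_unit:
  assumes A: "A \<in> Ob D"
  shows "counit A \<cdot> unit A = Idn D A"
  using \<phi>_counit[OF A] \<phi>_eq_Cmp_unit[OF A shift_counit_hom[OF A]] by (simp add: id_graph_map_def)

text \<open>Both sides have transpose \<open>unit A\<close>, so \<open>unit\<close> is the inverse
  of the counit.\<close>

lemma unit_Cmp_counit:
  assumes A: "A \<in> Ob D"
  shows "unit A \<cdot> counit A = Idn D (on_Ob F A)"
proof (rule \<phi>_inject[OF _ A])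
  show "\<phi> A (on_Ob F A) (unit A \<cdot> counit A) = \<phi> A (on_Ob F A) (Idn D (on_Ob F A))"
    using \<phi>_Cmp_counit[OF shift_unit_hom[OF A]] by (simp add: unit_def id_graph_map_def)
qed (use F.C.Cmp_hom[OF shift_counit_hom shift_unit_hom] F.C.Idn_hom F.on_Ob A in auto)

text \<open>Both sides have transpose \<open>g\<close>. No condition on \<open>g\<close> enters,
  although \<open>F\<close> need not preserve all composites.\<close>

lemma counit_natural:
  assumes g: "g \<in> hom D A B"
  shows "counit B \<cdot> on_Ar F g = g \<cdot> counit A"
proof (rule \<phi>_inject)
  note ob = F.C.hom_Ob[OF g]
  show "\<phi> A B (counit B \<cdot> on_Ar F g) = \<phi> A B (g \<cdot> counit A)"
    using \<phi>_natural_left[OF g shift_counit_hom[OF ob(2)]] \<phi>_counit[OF ob(2)] \<phi>_Cmp_counit[OF g]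
      F.C.Idn_left[OF g]
    by (simp add: id_graph_map_def)
  show "counit B \<cdot> on_Ar F g \<in> hom D (on_Ob F A) B"
    using F.C.Cmp_hom[OF F.on_Ar[OF g] shift_counit_hom[OF ob(2)]] .
  show "g \<cdot> counit A \<in> hom D (on_Ob F A) B"
    using F.C.Cmp_hom[OF shift_counit_hom[OF ob(1)] g] .
qed (use F.C.hom_Ob[OF g] in simp)

lemma counit_Cmp_bij:
  assumes P: "positive_object D P" and N: "negative_object D N"
  shows "bij_betw (\<lambda>f. counit N \<cdot> f) (hom (Pos_thunkable D) P (on_Ob F N)) (hom D P N)"
proof (rule bij_betw_byWitness[where f' = "\<lambda>f. unit N \<cdot> f"])
  have ob: "N \<in> Ob D" using N by (simp add: negative_object_def)
  note c = shift_counit_hom[OF ob] and u = shift_unit_hom[OF ob]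
  show "(\<lambda>f. counit N \<cdot> f) ` hom (Pos_thunkable D) P (on_Ob F N) \<subseteq> hom D P N"
    using F.C.Cmp_hom[OF _ c] by (auto simp: hom_Pos_thunkable)
  show "(\<lambda>f. unit N \<cdot> f) ` hom D P N \<subseteq> hom (Pos_thunkable D) P (on_Ob F N)"
    using F.C.Cmp_hom[OF _ u] F.C.thunkable_Cmp[OF _ _ u unit_thunkable[OF ob]]
      negative_objectD[OF N] P left_positive[OF ob]
    by (auto simp: hom_Pos_thunkable)
  \<comment> \<open>Both cancellations rebracket around \<open>f\<close>: here it is thunkable as an
    arrow of \<open>Pos_thunkable D\<close>, in the next one because its target is negative.\<close>
  show "\<forall>f \<in> hom (Pos_thunkable D) P (on_Ob F N). unit N \<cdot> (counit N \<cdot> f) = f"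
    using thunkable_arrowD[of D _ P "on_Ob F N", OF _ _ c u] unit_Cmp_counit[OF ob] F.C.Idn_left
    by (fastforce simp: hom_Pos_thunkable)
  show "\<forall>f \<in> hom D P N. counit N \<cdot> (unit N \<cdot> f) = f"
    using thunkable_arrowD[OF negative_objectD[OF N] _ u c] counit_Cmp_unit[OF ob] F.C.Idn_left
    by fastforce
qed

end

section \<open>The coadjunction relative to the down shift\<close>

theorem proposition38:
  fixes D :: "('o, 'm) cat_graph"
    and Down Up :: "('o, 'm, 'o, 'm) graph_map"
    and \<phi>_down \<phi>_up :: "'o \<Rightarrow> 'o \<Rightarrow> 'm \<Rightarrow> 'm"
    and S :: "('o, 'm) monoidal_data"
    and M :: "('x, 'u) cat_graph" and K :: "('x, 'u) product_data"
    and Lin :: "('x, 'u, 'o, 'm) graph_map" and \<mu> :: "'x \<Rightarrow> 'x \<Rightarrow> 'm" and \<eta> :: "'m"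
    and Mult :: "('o, 'm, 'x, 'u) graph_map" and \<phi> :: "'x \<Rightarrow> 'o \<Rightarrow> 'm \<Rightarrow> 'u"
  assumes "symmetric_monoidal_duploid D Down \<phi>_down Up \<phi>_up S"
    and "cartesian_category M K"
    and "direct_lnl_adjunction M K D S Lin \<mu> \<eta> Mult \<phi>"
  shows "\<exists>\<psi>. relative_lnl_coadjunction (Pos_thunkable D) S (Neg_linear D) Down
           M K Lin \<mu> \<eta> Mult \<psi>"
proof -
  interpret symmetric_monoidal_duploid D Down \<phi>_down Up \<phi>_up S by fact
  interpret lnl: direct_lnl_adjunction M K D S Lin \<mu> \<eta> Mult \<phi> by fact
  interpret shift_down: positive_shift D Down \<phi>_down ..
  interpret R: cat_functor "Neg_linear D" "Pos_thunkable D" Down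
    by (rule shift_down.left_adjoint_restricts)
  interpret Mult: cat_functor "Neg_linear D" M Mult
    by (rule lnl.right_adjoint_restricts) (rule lnl.category_axioms)
  define \<psi> where "\<psi> = (\<lambda>X N f. \<phi> X N (shift_down.counit N \<cdot>\<^bsub>D\<^esub> f))"
  have counit: "shift_down.counit N \<in> hom D (on_Ob Down N) N" if "negative_object D N" for N
    using that by (auto simp: negative_object_def intro: shift_down.shift_counit_hom)
  have "relative_lnl_coadjunction (Pos_thunkable D) S (Neg_linear D) Down M K Lin \<mu> \<eta> Mult \<psi>"
  \<comment> \<open>The interpretations above supply the monoidal, cartesian and functorial
    components; what remains is bijectivity of \<open>\<psi>\<close> and its two naturality
    conditions.\<close>
  proof unfold_locales
    fix X N assume X: "X \<in> Ob M" and "N \<in> Ob (Neg_linear D)"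
    then have N: "negative_object D N" by simp
    show "bij_betw (\<psi> X N) (hom (Pos_thunkable D) (on_Ob Lin X) (on_Ob Down N))
        (hom M X (on_Ob Mult N))"
      using bij_betw_trans[OF shift_down.counit_Cmp_bij[OF lnl.left_positive[OF X] N] lnl.\<phi>_bij[OF X]] N
      by (simp add: \<psi>_def comp_def negative_object_def)
  next
    fix u X' X N f
    assume u: "u \<in> hom M X' X" and "N \<in> Ob (Neg_linear D)"
      and "f \<in> hom (Pos_thunkable D) (on_Ob Lin X) (on_Ob Down N)"
    then have N: "negative_object D N" and f: "f \<in> hom D (on_Ob Lin X) (on_Ob Down N)"
      by (simp_all add: hom_Pos_thunkable)
    \<comment> \<open>\<open>Lin\<close> takes values in \<open>Pos_thunkable D\<close>, so the
      counit can be moved past \<open>on_Ar Lin u\<close> before left naturality of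
      \<open>\<phi>\<close> applies.\<close>
    have Lu: "on_Ar Lin u \<in> hom D (on_Ob Lin X') (on_Ob Lin X)"
      "thunkable_arrow D (on_Ar Lin u)"
      using lnl.Lin.on_Ar[OF u] by (simp_all add: hom_Pos_thunkable)
    show "\<psi> X' N (f \<cdot>\<^bsub>Pos_thunkable D\<^esub> on_Ar Lin u) = \<psi> X N f \<cdot>\<^bsub>M\<^esub> u"
      using lnl.\<phi>_natural_left[OF u Cmp_hom[OF f counit[OF N]]]
        thunkable_arrowD[OF Lu(2,1) f counit[OF N]]
      by (simp add: \<psi>_def)
  next
    fix X g N N' f
    assume X: "X \<in> Ob M" and "g \<in> hom (Neg_linear D) N N'"
      and "f \<in> hom (Pos_thunkable D) (on_Ob Lin X) (on_Ob Down N)"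
    then have g: "g \<in> hom D N N'" and N: "negative_object D N" "negative_object D N'"
      and f: "f \<in> hom D (on_Ob Lin X) (on_Ob Down N)" "thunkable_arrow D f"
      by (simp_all add: hom_Neg_linear hom_Pos_thunkable)
    \<comment> \<open>Naturality of the counit, framed by two rebracketings that hold because
      \<open>f\<close> is thunkable. It leaves \<open>g\<close> outermost, ready for right
      naturality of \<open>\<phi>\<close>.\<close>
    have "shift_down.counit N' \<cdot>\<^bsub>D\<^esub> (on_Ar Down g \<cdot>\<^bsub>D\<^esub> f) = g \<cdot>\<^bsub>D\<^esub> (shift_down.counit N \<cdot>\<^bsub>D\<^esub> f)"
      using thunkable_arrowD[OF f(2,1) shift_down.F.on_Ar[OF g] counit[OF N(2)]]
        thunkable_arrowD[OF f(2,1) counit[OF N(1)] g] shift_down.counit_natural[OF g]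
      by simp
    then show "\<psi> X N' (on_Ar Down g \<cdot>\<^bsub>Pos_thunkable D\<^esub> f) = on_Ar Mult g \<cdot>\<^bsub>M\<^esub> \<psi> X N f"
      using lnl.\<phi>_natural_right[OF X Cmp_hom[OF f(1) counit[OF N(1)]] g] by (simp add: \<psi>_def)
  qed
  then show ?thesis by blast
qed

end
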